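(* Let $q$ be a prime power, let $r\ge 2$ be an integer, and let $n=\frac{q^r-1}{q-1}$. Then the closed neighborhood ideal $\mathcal{N}_{\Gamma(n,q)}$ of the Hamming graph $\Gamma(n,q)$ satisfies $$q^{n-r}\le \mathtt{v}\big(\mathcal{N}_{\Gamma(n,q)}\big)\le q^{n-1}(q-1).$$
   Context: For a positive integer $m$, the Hamming graph $\Gamma(m,q)$ has vertex set $\mathbb{F}_q^m$, with two vertices $u,v$ joined by an edge if and only if they differ in exactly one coordinate (Hamming distance $\delta(u,v)=1$). For a finite simple graph $G$, let $\mathbb{K}$ be a field and $S$ the polynomial ring over $\mathbb{K}$ whose variables are the vertices of $G$, with the standard grading $S=\bigoplus_{d\ge 0}S_d$. For a vertex $v$, $\mathtt{N}[v]$ is the set consisting of $v$ and all its neighbors. For $A\subseteq V(G)$, $\mathbf{t}_A$ is the product of the variables in $A$. The closed neighborhood ideal of $G$ is $\mathcal{N}_G=\langle \mathbf{t}_{\mathtt{N}[v]} : v\in V(G)\rangle\subseteq S$. For a graded ideal $I\subseteq S$, $(I:f)=\{g\in S : gf\in I\}$, $\operatorname{Ass}(I)$ is the set of associated primes of $S/I$, and the $\mathtt{v}$-number of $I$ is $$\mathtt{v}(I)=\min\{d\ge 0 : \exists\, f\in S_d \text{ and } \mathfrak{p}\in\operatorname{Ass}(I)\text{ with }(I:f)=\mathfrak{p}\}.$$ *)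

theory Defs
  imports
    "HOL-Library.Poly_Mapping"
    "HOL-Analysis.Finite_Cartesian_Product"
    "HOL-Algebra.Algebraic_Closure_Type"
    "HOL-Algebra.QuotRing"
    "HOL-Number_Theory.Prime_Powers"
begin

section \<open>The polynomial ring on a set of variables\<close>

text \<open>
  A monomial is a finitely supported exponent function, a polynomial a finitely supported
  function from monomials to coefficients. The set of variables is the whole type \<open>'v\<close>.
\<close>

type_synonym ('v, 'k) mpoly = "('v \<Rightarrow>\<^sub>0 nat) \<Rightarrow>\<^sub>0 'k"

abbreviation poly_ring :: "('v, 'k::field) mpoly ring"
  where "poly_ring \<equiv> ring_of_type_algebra"

definition Var :: "'v \<Rightarrow> ('v, 'k::field) mpoly"
  where "Var v = Poly_Mapping.single (Poly_Mapping.single v 1) 1"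

definition graded_part :: "nat \<Rightarrow> ('v, 'k::field) mpoly set"
  where "graded_part d =
    {f. \<forall>m \<in> Poly_Mapping.keys f. (\<Sum>v \<in> Poly_Mapping.keys m. Poly_Mapping.lookup m v) = d}"

definition colon :: "('v, 'k::field) mpoly set \<Rightarrow> ('v, 'k) mpoly \<Rightarrow> ('v, 'k) mpoly set"
  where "colon I f = {g. g * f \<in> I}"

text \<open>
  Associated primes of \<open>S/I\<close>, i.e. the prime ideals of \<open>S\<close> that are the annihilator of an
  element of the \<open>S\<close>-module \<open>S/I\<close>. The scalar \<open>a\<close> acts as multiplication by its residue class,
  and \<open>I\<close> itself is the zero of the quotient.
\<close>

definition associated_primes :: "('v, 'k::field) mpoly set \<Rightarrow> ('v, 'k) mpoly set set"
  where "associated_primes I =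
    {p. primeideal p poly_ring \<and>
        (\<exists>x \<in> carrier (poly_ring Quot I).
           p = {a \<in> carrier poly_ring.
                  (I +>\<^bsub>poly_ring\<^esub> a) \<otimes>\<^bsub>poly_ring Quot I\<^esub> x = \<zero>\<^bsub>poly_ring Quot I\<^esub>})}"

definition v_number :: "('v, 'k::field) mpoly set \<Rightarrow> nat"
  where "v_number I =
    (LEAST d. \<exists>f \<in> graded_part d. \<exists>p \<in> associated_primes I. colon I f = p)"


section \<open>Closed neighborhood ideals\<close>

text \<open>
  A finite simple graph is given by its adjacency relation (symmetric and irreflexive) on the
  finite type \<open>'v\<close> of all its vertices.
\<close>

definition closed_nbhd :: "('v \<Rightarrow> 'v \<Rightarrow> bool) \<Rightarrow> 'v \<Rightarrow> 'v set"
  where "closed_nbhd E v = insert v {u. E v u}"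

definition var_prod :: "'v::finite set \<Rightarrow> ('v, 'k::field) mpoly"
  where "var_prod A = (\<Prod>v\<in>A. Var v)"

definition closed_nbhd_ideal :: "('v::finite \<Rightarrow> 'v \<Rightarrow> bool) \<Rightarrow> ('v, 'k::field) mpoly set"
  where "closed_nbhd_ideal E = Idl\<^bsub>poly_ring\<^esub> {var_prod (closed_nbhd E v) | v. True}"


section \<open>Hamming graphs\<close>

definition hamming_dist :: "'f ^ 'n \<Rightarrow> 'f ^ 'n::finite \<Rightarrow> nat"
  where "hamming_dist u v = card {i. u $ i \<noteq> v $ i}"

text \<open>The Hamming graph \<open>\<Gamma>(m, q)\<close> for \<open>m = CARD('n)\<close> and \<open>q = CARD('f)\<close>.\<close>

definition hamming_graph :: "'f ^ 'n \<Rightarrow> 'f ^ 'n::finite \<Rightarrow> bool"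
  where "hamming_graph u v \<longleftrightarrow> hamming_dist u v = 1"

lemma hamming_graph_simple:
  shows "symp hamming_graph" and "irreflp hamming_graph"
  by (auto simp: symp_def irreflp_def hamming_graph_def hamming_dist_def eq_commute)

end

theory Submission
  imports Defs
begin

text \<open>
  Both bounds come from reading the condition \<open>(I : f) = p\<close> off monomials. The closed
  neighborhood ideal \<open>I\<close> is a squarefree monomial ideal: a polynomial lies in it iff the support
  of each of its monomials contains some closed neighborhood \<open>N[v]\<close>.

  \<^emph>\<open>Lower bound\<close> (\<open>regular_graph_degree_bound\<close>). Let \<open>(I : f)\<close> be prime and let \<open>C\<close> be the set
  of variables in it. The colon ideal contains every product of a closed neighborhood, hence, being
  prime, one of its variables: \<open>C\<close> is a dominating set. Some monomial of \<open>f\<close> is not in \<open>I\<close>;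
  let \<open>A\<close> be its support, so that \<open>|A| \<le> deg f\<close>. Multiplying this monomial by a variable
  \<open>c \<in> C\<close> moves it into \<open>I\<close>, which gives a vertex \<open>w c\<close> with \<open>N[w c] - A = {c}\<close>. If all closed
  neighborhoods have \<open>D\<close> elements, the incidences \<open>a \<in> N[w c]\<close> between \<open>A\<close> and \<open>C\<close> number
  \<open>(D - 1) |C|\<close>. An element \<open>a \<in> A\<close> takes part in at most \<open>D - 1\<close> of them, so \<open>|C| \<le> |A|\<close>,
  and domination gives \<open>|V| \<le> D |C| \<le> D deg f\<close>. In the Hamming graph \<open>|V| = q\<^sup>n\<close> and
  \<open>D = 1 + n (q - 1) = q\<^sup>r\<close>; this is the sphere-covering bound, and the value of \<open>n\<close> serves to
  make \<open>D\<close> a power of \<open>q\<close>.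

  \<^emph>\<open>Upper bound\<close> (\<open>minimal_dominating_set_witness\<close>). If \<open>B\<close> is a minimal dominating set, then the
  product of the variables outside \<open>B\<close> has as colon ideal the ideal generated by the variables in
  \<open>B\<close>, which is prime (\<open>prime_variable_ideal\<close>). In the Hamming graph a coordinate hyperplane is
  a minimal dominating set, because each vertex off it has exactly one neighbor on it; its
  complement has \<open>q\<^sup>n\<^sup>-\<^sup>1 (q - 1)\<close> elements. This witness also shows that the minimum defining the
  v-number is attained, which the lower bound relies on.
\<close>

section \<open>Products of polynomials\<close>

lemma lookup_mult_keys:
  fixes f g :: "('v, 'k::field) mpoly"
  shows "Poly_Mapping.lookup (f * g) k =
    (\<Sum>(a, b) \<in> Poly_Mapping.keys f \<times> Poly_Mapping.keys g.
       Poly_Mapping.lookup f a * Poly_Mapping.lookup g b when k = a + b)"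
proof -
  have "Poly_Mapping.lookup (f * g) k =
      (\<Sum>(a, b). Poly_Mapping.lookup f a * Poly_Mapping.lookup g b when k = a + b)"
    by (simp add: times_poly_mapping.rep_eq prod_fun_unfold_prod)
  also have "\<dots> = (\<Sum>(a, b) \<in> Poly_Mapping.keys f \<times> Poly_Mapping.keys g.
       Poly_Mapping.lookup f a * Poly_Mapping.lookup g b when k = a + b)"
    by (rule Sum_any.expand_superset) (auto simp: in_keys_iff when_def split: if_splits)
  finally show ?thesis .
qed

lemma keys_mult_single:
  fixes f :: "('v, 'k::field) mpoly"
  shows "Poly_Mapping.keys (f * Poly_Mapping.single m 1) = (\<lambda>k. k + m) ` Poly_Mapping.keys f"
proof
  show "Poly_Mapping.keys (f * Poly_Mapping.single m 1) \<subseteq> (\<lambda>k. k + m) ` Poly_Mapping.keys f"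
    using keys_mult[of f "Poly_Mapping.single m 1"] by auto
  show "(\<lambda>k. k + m) ` Poly_Mapping.keys f \<subseteq> Poly_Mapping.keys (f * Poly_Mapping.single m 1)"
  proof clarify
    fix k assume k: "k \<in> Poly_Mapping.keys f"
    have "Poly_Mapping.lookup (f * Poly_Mapping.single m 1) (k + m) =
        (\<Sum>x \<in> Poly_Mapping.keys f \<times> {m}.
           if x = (k, m) then Poly_Mapping.lookup f k else 0)"
      unfolding lookup_mult_keys by (rule sum.cong) (auto simp: when_def split: if_splits)
    also have "\<dots> = Poly_Mapping.lookup f k"
      using k by (subst sum.delta) auto
    finally show "k + m \<in> Poly_Mapping.keys (f * Poly_Mapping.single m 1)"
      using k by (simp add: in_keys_iff)
  qed
qed

lemma keys_add_nat:
  "Poly_Mapping.keys (a + b) = Poly_Mapping.keys a \<union> Poly_Mapping.keys (b :: 'v \<Rightarrow>\<^sub>0 nat)"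
  by (auto simp: in_keys_iff lookup_add)

lemma poly_expansion:
  "f = (\<Sum>m\<in>Poly_Mapping.keys f. Poly_Mapping.single m (Poly_Mapping.lookup f m))"
proof (rule poly_mapping_eqI)
  fix k
  have "(\<Sum>m\<in>Poly_Mapping.keys f. Poly_Mapping.lookup (Poly_Mapping.single m (Poly_Mapping.lookup f m)) k)
      = (\<Sum>m\<in>Poly_Mapping.keys f. if m = k then Poly_Mapping.lookup f k else 0)"
    by (rule sum.cong) (auto simp: lookup_single when_def)
  then show "Poly_Mapping.lookup f k = Poly_Mapping.lookup
      (\<Sum>m\<in>Poly_Mapping.keys f. Poly_Mapping.single m (Poly_Mapping.lookup f m)) k"
    by (simp add: lookup_sum in_keys_iff)
qed

definition sqfree_exp :: "'v::finite set \<Rightarrow> 'v \<Rightarrow>\<^sub>0 nat"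
  where "sqfree_exp A = (\<Sum>v\<in>A. Poly_Mapping.single v 1)"

lemma lookup_sqfree_exp: "Poly_Mapping.lookup (sqfree_exp A) v = (if v \<in> A then 1 else 0)"
  by (simp add: sqfree_exp_def lookup_sum lookup_single when_def)

lemma keys_sqfree_exp [simp]: "Poly_Mapping.keys (sqfree_exp A) = A"
  by (auto simp: in_keys_iff lookup_sqfree_exp split: if_splits)

lemma var_prod_eq_single: "(var_prod A :: ('v::finite, 'k::field) mpoly) = Poly_Mapping.single (sqfree_exp A) 1"
proof -
  have "finite A" by simp
  then show ?thesis unfolding var_prod_def sqfree_exp_def Var_def
    by (induction A rule: finite_induct) (auto simp: mult_single)
qed

lemma Var_eq_var_prod: "(Var v :: ('v::finite, 'k::field) mpoly) = var_prod {v}"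
  by (simp add: var_prod_def)

section \<open>Squarefree monomial ideals\<close>

lemma poly_ring_simps [simp]:
  "carrier (poly_ring :: ('v, 'k::field) mpoly ring) = UNIV"
  "x \<otimes>\<^bsub>poly_ring\<^esub> y = x * (y :: ('v, 'k) mpoly)"
  "x \<oplus>\<^bsub>poly_ring\<^esub> y = x + (y :: ('v, 'k) mpoly)"
  "\<zero>\<^bsub>poly_ring\<^esub> = (0 :: ('v, 'k) mpoly)"
  "\<one>\<^bsub>poly_ring\<^esub> = (1 :: ('v, 'k) mpoly)"
  by (simp_all add: ring_of_type_algebra_def)

lemma ideal_poly_ringI:
  fixes I :: "('v, 'k::field) mpoly set"
  assumes I0: "0 \<in> I" and Iadd: "\<And>a b. a \<in> I \<Longrightarrow> b \<in> I \<Longrightarrow> a + b \<in> I"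
    and Imult: "\<And>a b. a \<in> I \<Longrightarrow> b * a \<in> I"
  shows "ideal I poly_ring"
proof -
  interpret cring "poly_ring :: ('v, 'k) mpoly ring" by (rule cring_from_type_algebra)
  have inv: "inv\<^bsub>add_monoid poly_ring\<^esub> a \<in> I" if "a \<in> I" for a
  proof -
    have "\<ominus>\<^bsub>poly_ring\<^esub> a = - a" by (rule minus_equality) auto
    then show ?thesis using Imult[OF that, of "-1"] by (simp add: a_inv_def)
  qed
  show ?thesis
    by (rule idealI)
      (use inv I0 Iadd Imult in
        \<open>auto intro!: subgroup.intro simp: ring_axioms mult.commute\<close>)
qed

text \<open>
  Membership in the ideal generated by the squarefree monomials with supports in \<open>F\<close>, expressed
  monomial by monomial: a monomial is divisible by the squarefree one with support \<open>A\<close> iff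
  \<open>A\<close> lies in its support.
\<close>

definition squarefree_ideal :: "'v set set \<Rightarrow> ('v, 'k::field) mpoly set"
  where "squarefree_ideal F = {f. \<forall>m\<in>Poly_Mapping.keys f. \<exists>A\<in>F. A \<subseteq> Poly_Mapping.keys m}"

lemma ideal_squarefree_ideal: "ideal (squarefree_ideal F :: ('v, 'k::field) mpoly set) poly_ring"
proof (rule ideal_poly_ringI)
  fix a b :: "('v, 'k) mpoly"
  assume a: "a \<in> squarefree_ideal F"
  show "b * a \<in> squarefree_ideal F"
    unfolding squarefree_ideal_def
  proof clarify
    fix m assume "m \<in> Poly_Mapping.keys (b * a)"
    then obtain x y where m: "m = x + y" and y: "y \<in> Poly_Mapping.keys a"
      using keys_mult[of b a] by blast
    obtain A where "A \<in> F" "A \<subseteq> Poly_Mapping.keys y"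
      using a y unfolding squarefree_ideal_def by blast
    then show "\<exists>A\<in>F. A \<subseteq> Poly_Mapping.keys m"
      unfolding m keys_add_nat by blast
  qed
  assume b: "b \<in> squarefree_ideal F"
  then show "a + b \<in> squarefree_ideal F"
    using a keys_add[of a b] by (auto simp: squarefree_ideal_def)
qed (simp add: squarefree_ideal_def)

text \<open>
  The description by supports is itself an ideal containing the generators; conversely each monomial
  of one of its elements is a multiple of a generator, and the polynomial is the sum of these.
\<close>

lemma genideal_var_prod:
  "Idl\<^bsub>poly_ring\<^esub> (var_prod ` F) = (squarefree_ideal F :: ('v::finite, 'k::field) mpoly set)"
proof
  interpret cring "poly_ring :: ('v, 'k) mpoly ring" by (rule cring_from_type_algebra)
  show "Idl\<^bsub>poly_ring\<^esub> (var_prod ` F) \<subseteq> (squarefree_ideal F :: ('v, 'k) mpoly set)"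
    by (rule genideal_minimal[OF ideal_squarefree_ideal])
      (auto simp: squarefree_ideal_def var_prod_eq_single)
  interpret I: ideal "Idl\<^bsub>poly_ring\<^esub> (var_prod ` F)" "poly_ring :: ('v, 'k) mpoly ring"
    by (rule genideal_ideal) simp
  have gen: "var_prod A \<in> Idl\<^bsub>poly_ring\<^esub> (var_prod ` F :: ('v, 'k) mpoly set)" if "A \<in> F" for A
    using genideal_self[of "var_prod ` F"] that by auto
  show "(squarefree_ideal F :: ('v, 'k) mpoly set) \<subseteq> Idl\<^bsub>poly_ring\<^esub> (var_prod ` F)"
  proof
    fix f :: "('v, 'k) mpoly" assume f: "f \<in> squarefree_ideal F"
    have mono: "Poly_Mapping.single m c \<in> Idl\<^bsub>poly_ring\<^esub> (var_prod ` F)"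
      if m: "m \<in> Poly_Mapping.keys f" for m and c :: 'k
    proof -
      obtain A where A: "A \<in> F" "A \<subseteq> Poly_Mapping.keys m"
        using f m by (auto simp: squarefree_ideal_def)
      have "m = (m - sqfree_exp A) + sqfree_exp A"
      proof (rule poly_mapping_eqI)
        fix v show "Poly_Mapping.lookup m v = Poly_Mapping.lookup (m - sqfree_exp A + sqfree_exp A) v"
          using A(2) by (auto simp: lookup_add lookup_minus lookup_sqfree_exp in_keys_iff)
      qed
      then have "Poly_Mapping.single m c = Poly_Mapping.single (m - sqfree_exp A) c * var_prod A"
        by (simp add: var_prod_eq_single mult_single)
      then show ?thesis using I.I_l_closed[OF gen[OF A(1)]] by simp
    qed
    have "(\<Sum>m\<in>K. Poly_Mapping.single m (Poly_Mapping.lookup f m)) \<in> Idl\<^bsub>poly_ring\<^esub> (var_prod ` F)"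
      if "K \<subseteq> Poly_Mapping.keys f" for K
      using finite_subset[OF that finite_keys] that
    proof (induction K rule: finite_induct)
      case empty then show ?case using I.zero_closed by simp
    next
      case (insert x K) then show ?case using I.a_closed[OF mono[of x]] by simp
    qed
    from this[OF order_refl] show "f \<in> Idl\<^bsub>poly_ring\<^esub> (var_prod ` F)"
      unfolding poly_expansion[of f, symmetric] .
  qed
qed

lemma closed_nbhd_ideal_eq:
  "(closed_nbhd_ideal E :: ('v::finite, 'k::field) mpoly set) = squarefree_ideal (range (closed_nbhd E))"
proof -
  have gens: "{var_prod (closed_nbhd E v) | v. True} = (var_prod ` range (closed_nbhd E) :: ('v, 'k) mpoly set)"
    by blast
  show ?thesis unfolding closed_nbhd_ideal_def gens by (rule genideal_var_prod)
qed

lemma mult_var_prod_in_squarefree_ideal: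
  "f * var_prod A \<in> (squarefree_ideal F :: ('v::finite, 'k::field) mpoly set) \<longleftrightarrow>
    (\<forall>m\<in>Poly_Mapping.keys f. \<exists>B\<in>F. B \<subseteq> Poly_Mapping.keys m \<union> A)"
  by (simp add: squarefree_ideal_def var_prod_eq_single keys_mult_single keys_add_nat)

section \<open>Prime colon ideals\<close>

text \<open>
  Primality is proved with leading monomials, so monomials need a total order compatible with
  multiplication. The type of variables has no order, so numbering the variables embeds the
  exponents additively into \<open>nat \<Rightarrow>\<^sub>0 nat\<close>, which is linearly ordered lexicographically.
\<close>

definition nat_exp :: "('v::finite \<Rightarrow>\<^sub>0 nat) \<Rightarrow> (nat \<Rightarrow>\<^sub>0 nat)"
  where "nat_exp m = (\<Sum>v\<in>UNIV. Poly_Mapping.single (to_nat_on UNIV v) (Poly_Mapping.lookup m v))"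

lemma nat_exp_add: "nat_exp (a + b) = nat_exp a + nat_exp b"
  by (simp add: nat_exp_def lookup_add single_add sum.distrib)

lemma lookup_nat_exp: "Poly_Mapping.lookup (nat_exp m) (to_nat_on UNIV v) = Poly_Mapping.lookup m v"
proof -
  have "inj (to_nat_on (UNIV :: 'a set))" by (rule inj_on_to_nat_on) (simp add: countable_finite)
  then have "Poly_Mapping.lookup (Poly_Mapping.single (to_nat_on UNIV w) (Poly_Mapping.lookup m w)) (to_nat_on UNIV v)
      = (if w = v then Poly_Mapping.lookup m v else 0)" for w
    by (auto simp: lookup_single when_def inj_eq)
  then show ?thesis by (simp add: nat_exp_def lookup_sum)
qed

lemma inj_nat_exp: "inj nat_exp"
  by (rule injI, rule poly_mapping_eqI) (metis lookup_nat_exp)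

text \<open>
  A polynomial lies outside the ideal generated by the variables in \<open>B\<close> iff it has a monomial free
  of \<open>B\<close>. For two such polynomials, the product of their leading \<open>B\<close>-free monomials occurs in the
  product of the polynomials: a \<open>B\<close>-free monomial factors only into \<open>B\<close>-free monomials, and by
  the choice of the leading ones no other pair of terms contributes to it.
\<close>

lemma prime_variable_ideal:
  "primeideal (squarefree_ideal ((\<lambda>b. {b}) ` B) :: ('v::finite, 'k::field) mpoly set) poly_ring"
    (is "primeideal ?P _")
proof (rule primeidealI[OF ideal_squarefree_ideal cring_from_type_algebra])
  have mem: "f \<in> ?P \<longleftrightarrow> (\<forall>m\<in>Poly_Mapping.keys f. Poly_Mapping.keys m \<inter> B \<noteq> {})" for f
    by (auto simp: squarefree_ideal_def)
  have "1 \<notin> ?P" by (simp add: mem)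
  then show "carrier poly_ring \<noteq> ?P" by auto
  fix f g :: "('v, 'k) mpoly"
  assume fg: "f \<otimes>\<^bsub>poly_ring\<^esub> g \<in> ?P"
  show "f \<in> ?P \<or> g \<in> ?P"
  proof (rule ccontr)
    assume outside: "\<not> (f \<in> ?P \<or> g \<in> ?P)"
    define K where "K h = {m \<in> Poly_Mapping.keys h. Poly_Mapping.keys m \<inter> B = {}}" for h :: "('v, 'k) mpoly"
    have top: "\<exists>m\<in>K h. \<forall>a\<in>K h. nat_exp a \<le> nat_exp m" if "h \<notin> ?P" for h
    proof -
      have fin: "finite (nat_exp ` K h)" by (simp add: K_def)
      have "nat_exp ` K h \<noteq> {}" using that unfolding mem K_def by blast
      then have "Max (nat_exp ` K h) \<in> nat_exp ` K h" by (rule Max_in[OF fin])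
      then obtain m where m: "m \<in> K h" "Max (nat_exp ` K h) = nat_exp m" by blast
      have "nat_exp a \<le> nat_exp m" if "a \<in> K h" for a
        unfolding m(2)[symmetric] by (rule Max_ge[OF fin imageI[OF that]])
      then show ?thesis using m(1) by blast
    qed
    obtain m where m: "m \<in> K f" "\<And>a. a \<in> K f \<Longrightarrow> nat_exp a \<le> nat_exp m"
      using top[of f] outside by blast
    obtain n where n: "n \<in> K g" "\<And>a. a \<in> K g \<Longrightarrow> nat_exp a \<le> nat_exp n"
      using top[of g] outside by blast
    have mn: "Poly_Mapping.keys (m + n) \<inter> B = {}"
      using m(1) n(1) by (auto simp: K_def keys_add_nat)
    have uniq: "a = m \<and> b = n"
      if ab: "a \<in> Poly_Mapping.keys f" "b \<in> Poly_Mapping.keys g" "m + n = a + b" for a b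
    proof -
      have "a \<in> K f" "b \<in> K g" using ab mn by (auto simp: K_def keys_add_nat)
      then have le: "nat_exp a \<le> nat_exp m" "nat_exp b \<le> nat_exp n" using m n by auto
      moreover have "nat_exp m + nat_exp n = nat_exp a + nat_exp b"
        using ab(3) by (metis nat_exp_add)
      ultimately have "nat_exp a = nat_exp m"
        by (metis add_less_le_mono order_less_irrefl order_le_less)
      then have "a = m" by (rule injD[OF inj_nat_exp])
      then show ?thesis using ab(3) by simp
    qed
    have "Poly_Mapping.lookup (f * g) (m + n) =
        (\<Sum>x \<in> Poly_Mapping.keys f \<times> Poly_Mapping.keys g.
           if x = (m, n) then Poly_Mapping.lookup f m * Poly_Mapping.lookup g n else 0)"
      unfolding lookup_mult_keys by (rule sum.cong) (auto simp: when_def dest: uniq split: if_splits)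
    also have "\<dots> = Poly_Mapping.lookup f m * Poly_Mapping.lookup g n"
      using m(1) n(1) by (subst sum.delta) (auto simp: K_def)
    finally have "m + n \<in> Poly_Mapping.keys (f * g)"
      using m(1) n(1) by (auto simp: K_def in_keys_iff)
    then show False using fg mn by (auto simp: mem)
  qed
qed

text \<open>
  The colon ideal \<open>(I : f)\<close> is the annihilator of the residue class of \<open>f\<close>.
\<close>

lemma colon_in_associated_primes:
  fixes I :: "('v, 'k::field) mpoly set"
  assumes I: "ideal I poly_ring" and p: "primeideal (colon I f) poly_ring"
  shows "colon I f \<in> associated_primes I"
proof -
  interpret cring "poly_ring :: ('v, 'k) mpoly ring" by (rule cring_from_type_algebra)
  interpret ideal I poly_ring by (rule I)
  have car: "I +>\<^bsub>poly_ring\<^esub> f \<in> carrier (poly_ring Quot I)"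
    using a_rcosetsI[OF a_subset, of f] by (simp add: FactRing_def)
  have "(I +>\<^bsub>poly_ring\<^esub> a) \<otimes>\<^bsub>poly_ring Quot I\<^esub> (I +>\<^bsub>poly_ring\<^esub> f) = \<zero>\<^bsub>poly_ring Quot I\<^esub>
      \<longleftrightarrow> a * f \<in> I" for a
  proof -
    have "(I +>\<^bsub>poly_ring\<^esub> a) \<otimes>\<^bsub>poly_ring Quot I\<^esub> (I +>\<^bsub>poly_ring\<^esub> f) = I +>\<^bsub>poly_ring\<^esub> (a * f)"
      using rcoset_mult_add[of a f] by (simp add: FactRing_def)
    moreover have "I +>\<^bsub>poly_ring\<^esub> (a * f) = I \<longleftrightarrow> a * f \<in> I"
      using a_rcos_const[of "a * f"] rcos_const_imp_mem[of "a * f"] by (simp; blast)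
    ultimately show ?thesis by (simp add: FactRing_def)
  qed
  then have "colon I f = {a \<in> carrier poly_ring. (I +>\<^bsub>poly_ring\<^esub> a) \<otimes>\<^bsub>poly_ring Quot I\<^esub>
      (I +>\<^bsub>poly_ring\<^esub> f) = \<zero>\<^bsub>poly_ring Quot I\<^esub>}"
    by (simp add: colon_def)
  then show ?thesis using p car unfolding associated_primes_def by blast
qed

section \<open>Bounds for the v-number of a closed neighborhood ideal\<close>

text \<open>
  The condition \<open>priv\<close> expresses minimality of the dominating set \<open>B\<close>: each \<open>b \<in> B\<close> is the only
  element of \<open>B\<close> dominating some vertex. The witness is the product of the variables outside \<open>B\<close>:
  a monomial with support \<open>S\<close> carries it into the ideal iff \<open>S\<close> meets \<open>B\<close>, where domination
  gives one direction and minimality the other.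
\<close>

lemma minimal_dominating_set_witness:
  fixes E :: "'v::finite \<Rightarrow> 'v \<Rightarrow> bool"
  assumes dom: "\<And>v. closed_nbhd E v \<inter> B \<noteq> {}"
    and priv: "\<And>b. b \<in> B \<Longrightarrow> \<exists>w. closed_nbhd E w \<inter> B = {b}"
  shows "\<exists>f \<in> graded_part (card (- B)). \<exists>p \<in> associated_primes (closed_nbhd_ideal E :: ('v, 'k::field) mpoly set).
    colon (closed_nbhd_ideal E) f = p"
proof -
  let ?I = "closed_nbhd_ideal E :: ('v, 'k) mpoly set"
  have "(\<exists>A\<in>range (closed_nbhd E). A \<subseteq> S \<union> - B) \<longleftrightarrow> (\<exists>A\<in>(\<lambda>b. {b}) ` B. A \<subseteq> S)" for S
  proof
    assume "\<exists>A\<in>range (closed_nbhd E). A \<subseteq> S \<union> - B"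
    then obtain v where "closed_nbhd E v \<subseteq> S \<union> - B" by blast
    then have "S \<inter> B \<noteq> {}" using dom[of v] by blast
    then show "\<exists>A\<in>(\<lambda>b. {b}) ` B. A \<subseteq> S" by blast
  next
    assume "\<exists>A\<in>(\<lambda>b. {b}) ` B. A \<subseteq> S"
    then obtain b where b: "b \<in> B" "b \<in> S" by blast
    then obtain w where w: "closed_nbhd E w \<inter> B = {b}" using priv by blast
    have "x \<in> S" if "x \<in> closed_nbhd E w \<inter> B" for x
      using that b(2) unfolding w by simp
    then have "closed_nbhd E w \<subseteq> S \<union> - B" by blast
    then show "\<exists>A\<in>range (closed_nbhd E). A \<subseteq> S \<union> - B" by blast
  qed
  then have colon: "colon ?I (var_prod (- B)) = squarefree_ideal ((\<lambda>b. {b}) ` B)"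
    by (simp add: colon_def closed_nbhd_ideal_eq mult_var_prod_in_squarefree_ideal)
      (simp add: squarefree_ideal_def)
  have "colon ?I (var_prod (- B)) \<in> associated_primes ?I"
    using colon prime_variable_ideal
    by (intro colon_in_associated_primes) (auto simp: closed_nbhd_ideal_eq ideal_squarefree_ideal)
  moreover have "(var_prod (- B) :: ('v, 'k) mpoly) \<in> graded_part (card (- B))"
    by (simp add: graded_part_def var_prod_eq_single lookup_sqfree_exp)
  ultimately show ?thesis by blast
qed

text \<open>
  A count of incidences between \<open>A\<close> (the support of a monomial of \<open>f\<close>) and \<open>C\<close> (the variables in
  the colon ideal) gives \<open>|C| \<le> |A|\<close>, and \<open>C\<close> dominates the graph. The naive column count, at
  most \<open>D\<close> incidences for each \<open>a \<in> A\<close>, would yield only \<open>(D - 1) |C| \<le> D |A|\<close>.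
\<close>

lemma regular_graph_degree_bound:
  fixes E :: "'v::finite \<Rightarrow> 'v \<Rightarrow> bool"
  assumes sym: "symp E" and reg: "\<And>v. card (closed_nbhd E v) = D" and D: "D \<ge> 2"
    and f: "f \<in> graded_part d"
    and prime: "primeideal (colon (closed_nbhd_ideal E) f) (poly_ring :: ('v, 'k::field) mpoly ring)"
  shows "CARD('v) \<le> D * d"
proof -
  let ?I = "closed_nbhd_ideal E :: ('v, 'k) mpoly set"
  let ?N = "closed_nbhd E"
  interpret p: primeideal "colon ?I f" "poly_ring :: ('v, 'k) mpoly ring" by (rule prime)
  have Nsym: "u \<in> ?N v \<longleftrightarrow> v \<in> ?N u" for u v
    using sym by (auto simp: closed_nbhd_def symp_def)
  define C where "C = {c. Var c \<in> colon ?I f}"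
  have "f \<notin> ?I" using p.one_imp_carrier p.I_notcarr by (auto simp: colon_def)
  then obtain m where m: "m \<in> Poly_Mapping.keys f" "\<And>v. \<not> ?N v \<subseteq> Poly_Mapping.keys m"
    by (auto simp: closed_nbhd_ideal_eq squarefree_ideal_def)
  define A where "A = Poly_Mapping.keys m"
  have card_A: "card A \<le> d"
  proof -
    have "card A = (\<Sum>v\<in>A. 1)" by simp
    also have "\<dots> \<le> (\<Sum>v\<in>A. Poly_Mapping.lookup m v)"
      by (rule sum_mono) (auto simp: A_def in_keys_iff)
    also have "\<dots> = d" using f m(1) by (auto simp: A_def graded_part_def)
    finally show ?thesis .
  qed
  have dom: "?N v \<inter> C \<noteq> {}" for v
  proof -
    have "f * var_prod (?N v) \<in> ?I"
      by (auto simp: closed_nbhd_ideal_eq mult_var_prod_in_squarefree_ideal)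
    then have "var_prod (?N v) \<in> colon ?I f" by (simp add: colon_def mult.commute)
    moreover have "\<exists>c\<in>S. Var c \<in> colon ?I f" if "var_prod S \<in> colon ?I f" for S
    proof -
      have "finite S" by simp
      then show ?thesis using that
      proof (induction S rule: finite_induct)
        case empty
        then show ?case using \<open>f \<notin> ?I\<close> by (simp add: var_prod_def colon_def)
      next
        case (insert x S)
        then have "Var x * var_prod S \<in> colon ?I f" by (simp add: var_prod_def)
        then show ?case using p.I_prime[of "Var x" "var_prod S"] insert.IH by auto
      qed
    qed
    ultimately show ?thesis by (auto simp: C_def)
  qed
  have "\<exists>v. ?N v - A = {c}" if "c \<in> C" for c
  proof -
    have "f * var_prod {c} \<in> ?I" using that by (simp add: C_def colon_def mult.commute Var_eq_var_prod)
    then obtain v where "?N v \<subseteq> A \<union> {c}"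
      using m(1) by (auto simp: closed_nbhd_ideal_eq mult_var_prod_in_squarefree_ideal A_def)
    then show ?thesis using m(2)[of v] by (intro exI[of _ v]) (auto simp: A_def)
  qed
  then obtain w where w: "\<And>c. c \<in> C \<Longrightarrow> ?N (w c) - A = {c}" by metis
  have w_inj: "inj_on w C" by (rule inj_onI) (metis w singleton_inject)
  have "CARD('v) \<le> (\<Sum>c\<in>C. card (?N c))"
  proof -
    have "UNIV = (\<Union>c\<in>C. ?N c)" using dom Nsym by blast
    then have "CARD('v) = card (\<Union>c\<in>C. ?N c)" by simp
    also have "\<dots> \<le> (\<Sum>c\<in>C. card (?N c))" by (rule card_UN_le) simp
    finally show ?thesis .
  qed
  then have cover: "CARD('v) \<le> D * card C" by (simp add: reg mult.commute)
  have row: "card {a\<in>A. a \<in> ?N (w c)} = D - 1" if "c \<in> C" for c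
  proof -
    have "{a\<in>A. a \<in> ?N (w c)} = ?N (w c) - {c}" using w[OF that] by auto
    moreover have "c \<in> ?N (w c)" using w[OF that] by auto
    ultimately show ?thesis using reg by simp
  qed
  have col: "card {c\<in>C. a \<in> ?N (w c)} \<le> D - 1" if "a \<in> A" for a
  proof -
    have sub: "w ` {c\<in>C. a \<in> ?N (w c)} \<subseteq> ?N a" using Nsym by auto
    \<comment> \<open>Equality is impossible: if \<open>a = w c\<close>, the only vertex of \<open>N[a]\<close> outside \<open>A\<close> is \<open>c\<close>. If
      also \<open>c = w c'\<close>, then \<open>c \<in> N[c] - A = {c'}\<close> forces \<open>c' = c\<close>, so \<open>a = c\<close>, although
      \<open>a \<in> A\<close>.\<close>
    have "w ` {c\<in>C. a \<in> ?N (w c)} \<noteq> ?N a"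
    proof
      assume eq: "w ` {c\<in>C. a \<in> ?N (w c)} = ?N a"
      have "a \<in> ?N a" by (simp add: closed_nbhd_def)
      then obtain c where c: "c \<in> C" "w c = a" unfolding eq[symmetric] by blast
      then have cN: "c \<in> ?N a" "c \<notin> A" using w[OF c(1)] by auto
      obtain c' where c': "c' \<in> C" "w c' = c" using cN(1) unfolding eq[symmetric] by blast
      have "c \<in> ?N c" by (simp add: closed_nbhd_def)
      then have "c' = c" using w[OF c'(1)] cN(2) c'(2) by auto
      then show False using c c' cN(2) that by auto
    qed
    then have "card (w ` {c\<in>C. a \<in> ?N (w c)}) < D"
      using sub psubset_card_mono[of "?N a"] by (simp add: reg psubset_eq)
    moreover have "card (w ` {c\<in>C. a \<in> ?N (w c)}) = card {c\<in>C. a \<in> ?N (w c)}"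
      by (rule card_image) (rule inj_on_subset[OF w_inj], auto)
    ultimately show ?thesis by simp
  qed
  have "(D - 1) * card C = (\<Sum>a\<in>A. card {c\<in>C. a \<in> ?N (w c)})"
    using sum_multicount[of A C "\<lambda>a c. a \<in> ?N (w c)" "D - 1"] row by simp
  also have "\<dots> \<le> (\<Sum>a\<in>A. D - 1)" by (rule sum_mono) (rule col)
  also have "\<dots> = (D - 1) * card A" by simp
  finally have "card C \<le> card A" using D by simp
  then have "D * card C \<le> D * d" using card_A by simp
  then show ?thesis using cover by linarith
qed

section \<open>Hamming graphs\<close>

text \<open>Neighbors of \<open>u\<close> correspond to pairs of a coordinate and a new value for it.\<close>

lemma card_closed_nbhd_hamming:
  "card (closed_nbhd hamming_graph (u :: 'f::finite ^ 'n::finite)) = 1 + CARD('n) * (CARD('f) - 1)"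
proof -
  define h where "h = (\<lambda>(i, x). \<chi> j. if j = i then x else u $ j)"
  let ?S = "SIGMA i:(UNIV :: 'n set). UNIV - {u $ i}"
  have "{v. hamming_graph u v} = h ` ?S"
  proof (intro equalityI subsetI)
    fix v assume "v \<in> {v. hamming_graph u v}"
    then obtain i where i: "{i. u $ i \<noteq> v $ i} = {i}"
      by (auto simp: hamming_graph_def hamming_dist_def card_1_singleton_iff)
    then have ne: "j = i" if "u $ j \<noteq> v $ j" for j using that by blast
    have "u $ j = v $ j" if "j \<noteq> i" for j using ne that by blast
    then have "v = h (i, v $ i)" by (simp add: h_def vec_eq_iff)
    moreover have "i \<in> {i. u $ i \<noteq> v $ i}" by (simp only: i singleton_iff)
    then have "(i, v $ i) \<in> ?S" by auto
    ultimately show "v \<in> h ` ?S" by blast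
  next
    fix v assume "v \<in> h ` ?S"
    then obtain i x where ix: "x \<noteq> u $ i" "v = h (i, x)" by auto
    then have "{j. u $ j \<noteq> v $ j} = {i}" by (auto simp: h_def)
    then show "v \<in> {v. hamming_graph u v}" by (simp add: hamming_graph_def hamming_dist_def)
  qed
  moreover have "inj_on h ?S"
  proof (rule inj_onI)
    fix p p' assume "p \<in> ?S" "p' \<in> ?S" and eq: "h p = h p'"
    then obtain i x j y where p: "p = (i, x)" "p' = (j, y)" "x \<noteq> u $ i" "y \<noteq> u $ j" by auto
    have "h (i, x) $ i = x" by (simp add: h_def)
    moreover have "h (j, y) $ i = (if i = j then y else u $ i)" by (simp add: h_def)
    ultimately show "p = p'" using p eq by (metis (full_types))
  qed
  ultimately have "card {v. hamming_graph u v} = CARD('n) * (CARD('f) - 1)"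
    by (simp add: card_image)
  moreover have "\<not> hamming_graph u u" by (simp add: hamming_graph_def hamming_dist_def)
  ultimately show ?thesis by (simp add: closed_nbhd_def)
qed

lemma hamming_graph_update:
  fixes u :: "'f ^ 'n::finite"
  assumes "x \<noteq> u $ i"
  shows "hamming_graph u (\<chi> j. if j = i then x else u $ j)"
proof -
  have "{j. u $ j \<noteq> (\<chi> j. if j = i then x else u $ j) $ j} = {i}"
    using assms by auto
  then show ?thesis by (simp add: hamming_graph_def hamming_dist_def)
qed

lemma hamming_graph_agree_off:
  fixes u :: "'f ^ 'n::finite"
  assumes "hamming_graph u v" "u $ i \<noteq> v $ i" "j \<noteq> i"
  shows "u $ j = v $ j"
proof (rule ccontr)
  assume "u $ j \<noteq> v $ j"
  then have "card {i, j} \<le> card {i. u $ i \<noteq> v $ i}" using assms by (intro card_mono) auto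
  then show False using assms by (simp add: hamming_graph_def hamming_dist_def)
qed

text \<open>
  The projection onto a coordinate hyperplane is the only way to reach it from a vertex off it by
  changing one coordinate. Hence the hyperplane dominates the graph, and a vertex off it is
  dominated by a single point of the hyperplane, its projection.
\<close>

lemma hyperplane_nbhd:
  fixes u :: "'f::zero ^ 'n::finite"
  assumes "u $ i \<noteq> 0"
  shows "closed_nbhd hamming_graph u \<inter> {x. x $ i = 0} = {\<chi> j. if j = i then 0 else u $ j}"
proof (intro equalityI subsetI)
  fix v assume v: "v \<in> closed_nbhd hamming_graph u \<inter> {x. x $ i = 0}"
  then have "hamming_graph u v" "u $ i \<noteq> v $ i" using assms by (auto simp: closed_nbhd_def)
  then have "v $ j = (if j = i then 0 else u $ j)" for j
    using v hamming_graph_agree_off[of u v i j] by auto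
  then show "v \<in> {\<chi> j. if j = i then 0 else u $ j}" by (simp add: vec_eq_iff)
next
  fix v assume "v \<in> {\<chi> j. if j = i then 0 else u $ j}"
  then show "v \<in> closed_nbhd hamming_graph u \<inter> {x. x $ i = 0}"
    using hamming_graph_update[of 0 u i] assms by (auto simp: closed_nbhd_def)
qed

lemma card_off_hyperplane:
  "card (- {x :: 'f::{zero,finite} ^ 'n::finite. x $ i = 0}) = CARD('f) ^ (CARD('n) - 1) * (CARD('f) - 1)"
proof -
  let ?P = "PiE (UNIV :: 'n set) (\<lambda>j. if j = i then UNIV - {0 :: 'f} else UNIV)"
  have "bij_betw vec_lambda ?P (- {x :: 'f ^ 'n. x $ i = 0})"
    by (rule bij_betwI[where g = vec_nth]) (auto simp: PiE_iff split: if_splits)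
  then have "card (- {x :: 'f ^ 'n. x $ i = 0}) = card ?P" by (metis bij_betw_same_card)
  also have "\<dots> = (\<Prod>j\<in>UNIV. card (if j = i then UNIV - {0 :: 'f} else UNIV))"
    by (rule card_PiE) simp
  also have "\<dots> = card (UNIV - {0 :: 'f}) * (\<Prod>j\<in>UNIV - {i}. CARD('f))"
    by (subst prod.remove[of _ i]) (auto intro!: prod.cong)
  finally show ?thesis by (simp add: card_Diff_singleton mult.commute)
qed

theorem theorem5p5:
  fixes q r n :: nat
  assumes "primepow q" and "CARD('f::{field,finite}) = q"
    and "r \<ge> 2"
    and "n = (q ^ r - 1) div (q - 1)" and "CARD('n::finite) = n"
  shows "q ^ (n - r) \<le> v_number (closed_nbhd_ideal hamming_graph :: ('f ^ 'n, 'k::field) mpoly set) \<and>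
    v_number (closed_nbhd_ideal hamming_graph :: ('f ^ 'n, 'k) mpoly set) \<le> q ^ (n - 1) * (q - 1)"
proof
  let ?I = "closed_nbhd_ideal hamming_graph :: ('f ^ 'n, 'k) mpoly set"
  let ?P = "\<lambda>d. \<exists>f \<in> graded_part d. \<exists>p \<in> associated_primes ?I. colon ?I f = p"
  fix i :: 'n
  let ?B = "{x :: 'f ^ 'n. x $ i = 0}"
  have q: "q \<ge> 2" using assms(1) primepow_gt_Suc_0 by fastforce
  have "?P (card (- ?B))"
  proof (rule minimal_dominating_set_witness)
    fix v :: "'f ^ 'n"
    show "closed_nbhd hamming_graph v \<inter> ?B \<noteq> {}"
      using hyperplane_nbhd[of v i] by (cases "v $ i = 0") (auto simp: closed_nbhd_def)
  next
    fix b assume b: "b \<in> ?B"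
    \<comment> \<open>Any nonzero value of coordinate \<open>i\<close> gives a vertex whose projection is \<open>b\<close>.\<close>
    define u where "u = (\<chi> j. if j = i then 1 else b $ j)"
    have "closed_nbhd hamming_graph u \<inter> ?B = {\<chi> j. if j = i then 0 else u $ j}"
      by (rule hyperplane_nbhd) (simp add: u_def)
    also have "(\<chi> j. if j = i then 0 else u $ j) = b" using b by (auto simp: u_def vec_eq_iff)
    finally show "\<exists>w. closed_nbhd hamming_graph w \<inter> ?B = {b}" by blast
  qed
  moreover have "card (- ?B) = q ^ (n - 1) * (q - 1)" using assms by (simp add: card_off_hyperplane)
  ultimately have P: "?P (q ^ (n - 1) * (q - 1))" by simp
  then show "v_number ?I \<le> q ^ (n - 1) * (q - 1)" unfolding v_number_def by (rule Least_le)
  have "?P (v_number ?I)" using P unfolding v_number_def by (rule LeastI)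
  then obtain f where f: "f \<in> graded_part (v_number ?I)" "primeideal (colon ?I f) poly_ring"
    by (auto simp: associated_primes_def)
  have "1 + (q - 1) * (\<Sum>k<r. q ^ k) = q ^ r"
  proof (induction r)
    case (Suc r)
    have "1 + (q - 1) * (\<Sum>k<Suc r. q ^ k) = q ^ r + (q - 1) * q ^ r"
      using Suc by (simp add: distrib_left)
    also have "\<dots> = (1 + (q - 1)) * q ^ r" by (simp only: distrib_right mult_1)
    finally show ?case using q by simp
  qed simp
  then have geom: "q ^ r - 1 = (q - 1) * (\<Sum>k<r. q ^ k)" by (metis add_diff_cancel_left')
  then have n_sum: "n = (\<Sum>k<r. q ^ k)" using assms(4) q by simp
  have "n * (q - 1) = q ^ r - 1" using geom n_sum by simp
  then have D: "1 + n * (q - 1) = q ^ r" using q by simp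
  have "(\<Sum>k<r. 1) \<le> (\<Sum>k<r. q ^ k)" by (rule sum_mono) (use q in simp)
  then have rn: "r \<le> n" using n_sum by simp
  have "CARD('f ^ 'n) \<le> q ^ r * v_number ?I"
  proof (rule regular_graph_degree_bound[OF hamming_graph_simple(1) _ _ f])
    show "card (closed_nbhd hamming_graph v) = q ^ r" for v :: "'f ^ 'n"
      using assms D by (simp add: card_closed_nbhd_hamming)
    have "2 ^ 1 \<le> q ^ 1" using q by simp
    also have "\<dots> \<le> q ^ r" using q assms(3) by (intro power_increasing) auto
    finally show "2 \<le> q ^ r" by simp
  qed
  moreover have "CARD('f ^ 'n) = q ^ r * q ^ (n - r)"
    using assms rn by (simp flip: power_add)
  ultimately show "q ^ (n - r) \<le> v_number ?I" using q by simp
qed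

end
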